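(* Let $P,Q$ be orthogonal projections in $(\mathscr{A},\tau)$, $R=2P-\mathbf 1$, $S=2Q-\mathbf 1$, $\alpha=\tau(R)$, $\beta=\tau(S)$, and let $(U_t)_{t\ge0}$ be a free unitary Brownian motion freely independent from $\{P,Q\}$. Let $\mu_t$ be the spectral measure on $[0,1]$ of $PU_tQU_t^*$ and $\nu_t$ the spectral measure on $\mathbb{T}\cong(-\pi,\pi]$ of $RU_tSU_t^*$. Let $\tilde\mu_t(d\theta)$ be the positive measure on $[0,\pi]$ obtained from $\mu_t(dx)$ via the change of variable $x=\cos^2(\theta/2)$, and let $\hat\mu_t:=\frac12\left(\tilde\mu_t+\tilde\mu_t\circ j^{-1}\right)$ be its symmetrization on $\mathbb{T}$, where $j:\theta\mapsto-\theta$ (modulo $2\pi$, so that $j$ fixes $0$ and $\pi$). Then for every $t\ge0$, $$\nu_t=2\hat\mu_t-\frac{2-\alpha-\beta}{2}\,\delta_\pi-\frac{\alpha+\beta}{2}\,\delta_0 .$$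
   Context: $(\mathscr{A},\tau)$ is a $W^*$-probability space (von Neumann algebra with faithful normal tracial state $\tau$). $(U_t)_{t\ge0}$, $U_0=\mathbf 1$, solves $dU_t=iU_t\,dB_t-\tfrac12U_t\,dt$ with $(B_t)$ a free additive (semicircular) Brownian motion, $\tau(B_t^2)=t$. $\mu_t$ is the probability measure on $[0,1]$ with moments $\int x^n\,d\mu_t(x)=\tau[(PU_tQU_t^* )^n]$, $n\ge1$ (equivalently the distribution of $PU_tQU_t^*P$). The unit circle is identified with $(-\pi,\pi]$ via $\theta\mapsto e^{i\theta}$; $\delta_0,\delta_\pi$ are Dirac masses at angles $0,\pi$. *)

theory Defs
  imports "HOL-Probability.Probability"
begin

section \<open>Complex Hilbert spaces and their bounded operators\<close>

class scaleC =
  fixes scaleC :: "complex \<Rightarrow> 'a \<Rightarrow> 'a" (infixr "*\<^sub>C" 75)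

text \<open>The inner product is linear in its second argument.\<close>

class complex_hilbert_space = banach + scaleC +
  fixes cinner :: "'a \<Rightarrow> 'a \<Rightarrow> complex"
  assumes scaleC_add_right: "c *\<^sub>C (x + y) = c *\<^sub>C x + c *\<^sub>C y"
    and scaleC_add_left: "(c + d) *\<^sub>C x = c *\<^sub>C x + d *\<^sub>C x"
    and scaleC_scaleC: "c *\<^sub>C d *\<^sub>C x = (c * d) *\<^sub>C x"
    and scaleR_scaleC: "r *\<^sub>R x = complex_of_real r *\<^sub>C x"
    and cinner_commute: "cinner x y = cnj (cinner y x)"
    and cinner_add_right: "cinner x (y + z) = cinner x y + cinner x z"
    and cinner_scaleC_right: "cinner x (c *\<^sub>C y) = c * cinner x y"
    and cinner_norm: "cinner x x = complex_of_real ((norm x)\<^sup>2)"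
begin

lemma cinner_scaleC_left: "cinner (c *\<^sub>C x) y = cnj c * cinner x y"
  using cinner_commute[of "c *\<^sub>C x" y] cinner_commute[of x y]
  by (simp add: cinner_scaleC_right)

lemma norm_scaleC: "norm (c *\<^sub>C x) = cmod c * norm x"
proof -
  have "complex_of_real ((norm (c *\<^sub>C x))\<^sup>2) = complex_of_real ((cmod c * norm x)\<^sup>2)"
    unfolding cinner_norm[symmetric] cinner_scaleC_right cinner_scaleC_left
    unfolding cinner_norm power_mult_distrib of_real_mult complex_norm_square
    by (simp add: mult_ac)
  then have "(norm (c *\<^sub>C x))\<^sup>2 = (cmod c * norm x)\<^sup>2"
    unfolding of_real_eq_iff .
  then show ?thesis
    by (rule power2_eq_imp_eq) simp_all
qed

end

definition bounded_clinear :: "('h::complex_hilbert_space \<Rightarrow> 'h) \<Rightarrow> bool" where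
  "bounded_clinear f \<longleftrightarrow> bounded_linear f \<and> (\<forall>c x. f (c *\<^sub>C x) = c *\<^sub>C f x)"

typedef (overloaded) ('h::complex_hilbert_space) bop = "{f :: 'h \<Rightarrow> 'h. bounded_clinear f}"
  morphisms app Abs_bop
proof
  show "(\<lambda>x. x) \<in> {f :: 'h \<Rightarrow> 'h. bounded_clinear f}"
    by (simp add: bounded_clinear_def)
qed

setup_lifting type_definition_bop

lemma scaleC_zero_right [simp]: "c *\<^sub>C (0::'h::complex_hilbert_space) = 0"
  using scaleC_add_right[of c 0 "0::'h"] by simp

lemma scaleC_minus_right: "c *\<^sub>C (- x) = - (c *\<^sub>C (x::'h::complex_hilbert_space))"
  using scaleC_add_right[of c x "- x"] by (simp add: eq_neg_iff_add_eq_0 add.commute)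

lemma scaleC_diff_right: "c *\<^sub>C (x - y) = c *\<^sub>C x - c *\<^sub>C (y::'h::complex_hilbert_space)"
  using scaleC_add_right[of c x "- y"] by (simp add: scaleC_minus_right)

lemma bounded_linear_scaleC: "bounded_linear (\<lambda>x::'h::complex_hilbert_space. c *\<^sub>C x)"
  by (rule bounded_linear_intro[where K = "cmod c"])
    (simp_all add: scaleC_add_right scaleR_scaleC scaleC_scaleC norm_scaleC mult.commute)

text \<open>Multiplication of operators is composition, so powers are iterated compositions.\<close>

instantiation bop :: (complex_hilbert_space) "{ring, monoid_mult, scaleC}"
begin

lift_definition zero_bop :: "'a bop" is "\<lambda>x. 0"
  by (simp add: bounded_clinear_def)

lift_definition one_bop :: "'a bop" is "\<lambda>x. x"
  by (simp add: bounded_clinear_def)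

lift_definition plus_bop :: "'a bop \<Rightarrow> 'a bop \<Rightarrow> 'a bop" is "\<lambda>f g x. f x + g x"
  by (simp add: bounded_clinear_def bounded_linear_add scaleC_add_right)

lift_definition minus_bop :: "'a bop \<Rightarrow> 'a bop \<Rightarrow> 'a bop" is "\<lambda>f g x. f x - g x"
  by (simp add: bounded_clinear_def bounded_linear_sub scaleC_diff_right)

lift_definition uminus_bop :: "'a bop \<Rightarrow> 'a bop" is "\<lambda>f x. - f x"
  by (simp add: bounded_clinear_def bounded_linear_minus scaleC_minus_right)

lift_definition times_bop :: "'a bop \<Rightarrow> 'a bop \<Rightarrow> 'a bop" is "\<lambda>f g x. f (g x)"
  by (auto simp: bounded_clinear_def intro: bounded_linear_compose)

lift_definition scaleC_bop :: "complex \<Rightarrow> 'a bop \<Rightarrow> 'a bop" is "\<lambda>c f x. c *\<^sub>C f x"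
  by (auto simp: bounded_clinear_def scaleC_scaleC mult.commute
      intro: bounded_linear_compose[OF bounded_linear_scaleC])

instance
proof
  fix a b c :: "'a bop"
  show "a + b + c = a + (b + c)" by transfer (simp add: add.assoc)
  show "a + b = b + a" by transfer (simp add: add.commute)
  show "0 + a = a" by transfer simp
  show "- a + a = 0" by transfer simp
  show "a - b = a + - b" by transfer simp
  show "a * b * c = a * (b * c)" by transfer simp
  show "1 * a = a" by transfer simp
  show "a * 1 = a" by transfer simp
  show "(a + b) * c = a * c + b * c" by transfer simp
  show "a * (b + c) = a * b + a * c"
    by transfer (auto simp: bounded_clinear_def linear_simps)
qed

end

definition is_adjoint :: "'h::complex_hilbert_space bop \<Rightarrow> 'h bop \<Rightarrow> bool" where
  "is_adjoint S T \<longleftrightarrow> (\<forall>x y. cinner (app S x) y = cinner x (app T y))"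

text \<open>By completeness of the space every bounded operator has exactly one adjoint.\<close>

definition adj :: "'h::complex_hilbert_space bop \<Rightarrow> 'h bop" where
  "adj T = (THE S. is_adjoint S T)"

definition positive_op :: "'h::complex_hilbert_space bop \<Rightarrow> bool" where
  "positive_op T \<longleftrightarrow> (\<forall>x. Im (cinner x (app T x)) = 0 \<and> 0 \<le> Re (cinner x (app T x)))"

definition op_le :: "'h::complex_hilbert_space bop \<Rightarrow> 'h bop \<Rightarrow> bool" where
  "op_le S T \<longleftrightarrow> positive_op (T - S)"

definition unitary_op :: "'h::complex_hilbert_space bop \<Rightarrow> bool" where
  "unitary_op U \<longleftrightarrow> adj U * U = 1 \<and> U * adj U = 1"

definition projection_op :: "'h::complex_hilbert_space bop \<Rightarrow> bool" where
  "projection_op P \<longleftrightarrow> adj P = P \<and> P * P = P"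


section \<open>\<open>W\<^sup>*\<close>-probability spaces\<close>

definition commutant :: "'h::complex_hilbert_space bop set \<Rightarrow> 'h bop set" where
  "commutant X = {S. \<forall>T\<in>X. S * T = T * S}"

definition von_neumann_algebra :: "'h::complex_hilbert_space bop set \<Rightarrow> bool" where
  "von_neumann_algebra M \<longleftrightarrow>
     (\<forall>T\<in>M. \<exists>S\<in>M. is_adjoint S T) \<and> commutant (commutant M) = M"

definition vN_generated :: "'h::complex_hilbert_space bop set \<Rightarrow> 'h bop set" where
  "vN_generated X = commutant (commutant (X \<union> adj ` X))"

text \<open>Normality: suprema of bounded increasing nets of positive elements are preserved.\<close>

definition normal_functional ::
    "'h::complex_hilbert_space bop set \<Rightarrow> ('h bop \<Rightarrow> complex) \<Rightarrow> bool" where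
  "normal_functional M \<tau> \<longleftrightarrow>
     (\<forall>D T. D \<noteq> {} \<and> D \<subseteq> M \<and> (\<forall>S\<in>D. positive_op S) \<and>
        (\<forall>S1\<in>D. \<forall>S2\<in>D. \<exists>S3\<in>D. op_le S1 S3 \<and> op_le S2 S3) \<and>
        T \<in> M \<and> (\<forall>S\<in>D. op_le S T) \<and>
        (\<forall>T'\<in>M. (\<forall>S\<in>D. op_le S T') \<longrightarrow> op_le T T')
        \<longrightarrow> Re (\<tau> T) = (SUP S\<in>D. Re (\<tau> S)))"

text \<open>Only the values of \<open>\<tau>\<close> on \<open>M\<close> are meaningful.\<close>

locale wstar_probability_space =
  fixes M :: "'h::complex_hilbert_space bop set" and \<tau> :: "'h bop \<Rightarrow> complex"
  assumes von_neumann: "von_neumann_algebra M"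
    and trace_add: "\<And>S T. S \<in> M \<Longrightarrow> T \<in> M \<Longrightarrow> \<tau> (S + T) = \<tau> S + \<tau> T"
    and trace_scaleC: "\<And>c T. T \<in> M \<Longrightarrow> \<tau> (c *\<^sub>C T) = c * \<tau> T"
    and trace_one: "\<tau> 1 = 1"
    and trace_positive: "\<And>T. T \<in> M \<Longrightarrow> Im (\<tau> (adj T * T)) = 0 \<and> 0 \<le> Re (\<tau> (adj T * T))"
    and trace_faithful: "\<And>T. T \<in> M \<Longrightarrow> \<tau> (adj T * T) = 0 \<Longrightarrow> T = 0"
    and trace_normal: "normal_functional M \<tau>"
    and trace_commute: "\<And>S T. S \<in> M \<Longrightarrow> T \<in> M \<Longrightarrow> \<tau> (S * T) = \<tau> (T * S)"

definition norm2 :: "('h::complex_hilbert_space bop \<Rightarrow> complex) \<Rightarrow> 'h bop \<Rightarrow> real" where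
  "norm2 \<tau> T = sqrt (Re (\<tau> (adj T * T)))"

text \<open>
  Freeness of a family of subalgebras: products of centred elements, neighbouring factors
  coming from different subalgebras, have trace zero.
\<close>

definition free_subalgebras ::
    "('h::complex_hilbert_space bop \<Rightarrow> complex) \<Rightarrow> 'i set \<Rightarrow> ('i \<Rightarrow> 'h bop set) \<Rightarrow> bool" where
  "free_subalgebras \<tau> I A \<longleftrightarrow>
     (\<forall>xs :: ('i \<times> 'h bop) list.
        xs \<noteq> [] \<and> (\<forall>(i, a)\<in>set xs. i \<in> I \<and> a \<in> A i \<and> \<tau> a = 0) \<and> distinct_adj (map fst xs)
        \<longrightarrow> \<tau> (prod_list (map snd xs)) = 0)"

definition freely_independent ::
    "('h::complex_hilbert_space bop \<Rightarrow> complex) \<Rightarrow> 'h bop set \<Rightarrow> 'h bop set \<Rightarrow> bool" where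
  "freely_independent \<tau> X Y \<longleftrightarrow>
     free_subalgebras \<tau> (UNIV :: bool set) (\<lambda>b. if b then vN_generated X else vN_generated Y)"


section \<open>Free additive and free unitary Brownian motion\<close>

definition semicircular ::
    "('h::complex_hilbert_space bop \<Rightarrow> complex) \<Rightarrow> real \<Rightarrow> 'h bop \<Rightarrow> bool" where
  "semicircular \<tau> v X \<longleftrightarrow> adj X = X \<and>
     (\<forall>n. \<tau> (X ^ n) = complex_of_real
        (integral {- 2 * sqrt v..2 * sqrt v} (\<lambda>x. x ^ n * (sqrt (4 * v - x\<^sup>2) / (2 * pi * v)))))"

definition past :: "(real \<Rightarrow> 'h::complex_hilbert_space bop) \<Rightarrow> real \<Rightarrow> 'h bop set" where
  "past B t = vN_generated (B ` {0..t})"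

definition free_brownian_motion ::
    "'h::complex_hilbert_space bop set \<Rightarrow> ('h bop \<Rightarrow> complex) \<Rightarrow> (real \<Rightarrow> 'h bop) \<Rightarrow> bool" where
  "free_brownian_motion M \<tau> B \<longleftrightarrow>
     (\<forall>t\<ge>0. B t \<in> M \<and> adj (B t) = B t) \<and> B 0 = 0 \<and>
     (\<forall>s t. 0 \<le> s \<and> s < t \<longrightarrow>
        semicircular \<tau> (t - s) (B t - B s) \<and>
        freely_independent \<tau> {B t - B s} (B ` {0..s}))"

definition simple_adapted ::
    "(real \<Rightarrow> 'h::complex_hilbert_space bop) \<Rightarrow> real \<Rightarrow> nat \<Rightarrow> (nat \<Rightarrow> real) \<Rightarrow> (nat \<Rightarrow> 'h bop) \<Rightarrow> bool"
  where
  "simple_adapted B t m s a \<longleftrightarrow>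
     s 0 = 0 \<and> s m = t \<and> (\<forall>k<m. s k \<le> s (Suc k) \<and> a k \<in> past B (s k))"

definition simple_process ::
    "nat \<Rightarrow> (nat \<Rightarrow> real) \<Rightarrow> (nat \<Rightarrow> 'h::complex_hilbert_space bop) \<Rightarrow> real \<Rightarrow> 'h bop" where
  "simple_process m s a r = (\<Sum>k<m. if s k \<le> r \<and> r < s (Suc k) then a k else 0)"

definition simple_integral ::
    "(real \<Rightarrow> 'h::complex_hilbert_space bop) \<Rightarrow> nat \<Rightarrow> (nat \<Rightarrow> real) \<Rightarrow> (nat \<Rightarrow> 'h bop) \<Rightarrow> 'h bop" where
  "simple_integral B m s a = (\<Sum>k<m. a k * (B (s (Suc k)) - B (s k)))"

text \<open>
  \<open>X = \<integral>\<^sub>0\<^sup>t A\<^sub>r dB\<^sub>r\<close> is the limit in \<open>\<parallel>\<cdot>\<parallel>\<^sub>2\<close> of the integrals of simple adapted processes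
  that approximate \<open>A\<close> in \<open>L\<^sup>2([0,t]; L\<^sup>2(\<tau>))\<close>; by the free Ito isometry
  it does not depend on the approximating sequence.
\<close>

definition has_free_integral ::
    "('h::complex_hilbert_space bop \<Rightarrow> complex) \<Rightarrow> (real \<Rightarrow> 'h bop) \<Rightarrow>
     (real \<Rightarrow> 'h bop) \<Rightarrow> real \<Rightarrow> 'h bop \<Rightarrow> bool" where
  "has_free_integral \<tau> B A t X \<longleftrightarrow> X \<in> past B t \<and>
     (\<exists>m s a e.
        (\<forall>n. simple_adapted B t (m n) (s n) (a n)) \<and>
        (\<forall>n. ((\<lambda>r. (norm2 \<tau> (A r - simple_process (m n) (s n) (a n) r))\<^sup>2)
               has_integral e n) {0..t}) \<and>
        e \<longlonglongrightarrow> (0::real) \<and>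
        (\<lambda>n. norm2 \<tau> (X - simple_integral B (m n) (s n) (a n))) \<longlonglongrightarrow> 0)"

text \<open>\<open>X = \<integral>\<^sub>0\<^sup>t A\<^sub>r dr\<close> in the weak operator sense.\<close>

definition has_time_integral ::
    "(real \<Rightarrow> 'h::complex_hilbert_space bop) \<Rightarrow> real \<Rightarrow> 'h bop \<Rightarrow> bool" where
  "has_time_integral A t X \<longleftrightarrow>
     (\<forall>x y. ((\<lambda>r. cinner x (app (A r) y)) has_integral cinner x (app X y)) {0..t})"

text \<open>
  The adapted process of unitaries with \<open>U\<^sub>0 = 1\<close> and
  \<open>dU\<^sub>t = \<i> U\<^sub>t dB\<^sub>t - \<onehalf> U\<^sub>t dt\<close>, the equation being read in integrated form.
\<close>

definition free_unitary_brownian_motion ::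
    "('h::complex_hilbert_space bop \<Rightarrow> complex) \<Rightarrow> (real \<Rightarrow> 'h bop) \<Rightarrow> (real \<Rightarrow> 'h bop) \<Rightarrow> bool" where
  "free_unitary_brownian_motion \<tau> B U \<longleftrightarrow>
     (\<forall>t\<ge>0. U t \<in> past B t \<and> unitary_op (U t)) \<and> U 0 = 1 \<and>
     (\<forall>t\<ge>0. \<exists>X Y. has_free_integral \<tau> B U t X \<and> has_time_integral U t Y \<and>
        U t = 1 + \<i> *\<^sub>C X - (1/2) *\<^sub>C Y)"


section \<open>Spectral measures\<close>

definition interval_spectral_measure ::
    "('h::complex_hilbert_space bop \<Rightarrow> complex) \<Rightarrow> 'h bop \<Rightarrow> real measure \<Rightarrow> bool" where
  "interval_spectral_measure \<tau> T \<mu> \<longleftrightarrow>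
     prob_space \<mu> \<and> sets \<mu> = sets borel \<and> (AE x in \<mu>. x \<in> {0..1}) \<and>
     (\<forall>n\<ge>1. \<tau> (T ^ n) = complex_of_real (LINT x|\<mu>. x ^ n))"

text \<open>
  Measures on the unit circle are represented by Borel measures on the line concentrated on
  \<open>(-\<pi>, \<pi>]\<close>, via \<open>\<theta> \<mapsto> exp (\<i> \<theta>)\<close>. For a unitary \<open>T\<close> the negative moments are the complex
  conjugates of the positive ones.
\<close>

definition circle_spectral_measure ::
    "('h::complex_hilbert_space bop \<Rightarrow> complex) \<Rightarrow> 'h bop \<Rightarrow> real measure \<Rightarrow> bool" where
  "circle_spectral_measure \<tau> T \<nu> \<longleftrightarrow>
     prob_space \<nu> \<and> sets \<nu> = sets borel \<and> (AE \<theta> in \<nu>. \<theta> \<in> {- pi<..pi}) \<and>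
     (\<forall>n::nat. \<tau> (T ^ n) = (LINT \<theta>|\<nu>. cis \<theta> ^ n))"

text \<open>
  Since \<open>\<theta> \<mapsto> cos\<^sup>2 (\<theta>/2)\<close> is a decreasing bijection of \<open>[0, \<pi>]\<close> onto \<open>[0, 1]\<close>, the change of
  variable is the push-forward under its inverse.
\<close>

definition angle_measure :: "real measure \<Rightarrow> real measure" where
  "angle_measure \<mu> = distr \<mu> borel (\<lambda>x. 2 * arccos (sqrt x))"

lemma measurable_angle: "(\<lambda>x::real. 2 * arccos (sqrt x)) \<in> borel_measurable borel"
proof -
  have const: "arccos y = (THE x. False)" if "y \<notin> {-1..1}" for y
  proof -
    have "(\<lambda>x. 0 \<le> x \<and> x \<le> pi \<and> cos x = y) = (\<lambda>x. False)"
      using that by auto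
    then show ?thesis unfolding arccos_def by simp
  qed
  have "(\<lambda>y. if y \<in> {-1..1} then arccos y else (THE x. False)) \<in> borel_measurable borel"
    by (rule borel_measurable_continuous_on_if) (auto intro!: continuous_intros)
  moreover have "(\<lambda>y. if y \<in> {-1..1} then arccos y else (THE x. False)) = arccos"
    using const by (auto simp: fun_eq_iff)
  ultimately have "arccos \<in> borel_measurable borel" by simp
  then show ?thesis by measurable
qed

definition circle_reflection :: "real \<Rightarrow> real" where
  "circle_reflection \<theta> = (if \<theta> = pi then pi else - \<theta>)"

definition symmetrized_measure :: "real measure \<Rightarrow> real measure" where
  "symmetrized_measure m = measure_of UNIV (sets borel)
     (\<lambda>A. (emeasure m A + emeasure (distr m borel circle_reflection) A) / 2)"

lemma emeasure_symmetrized_measure: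
  assumes "sets m = sets borel" "A \<in> sets borel"
  shows "emeasure (symmetrized_measure m) A =
    (emeasure m A + emeasure (distr m borel circle_reflection) A) / 2"
proof (rule emeasure_measure_of[OF symmetrized_measure_def])
  let ?f = "\<lambda>A. (emeasure m A + emeasure (distr m borel circle_reflection) A) / 2"
  have *: "sets (symmetrized_measure m) = sets borel"
    unfolding symmetrized_measure_def
    by (metis sets.sets_measure_of_eq space_borel)
  show "positive (sets (symmetrized_measure m)) ?f"
    by (simp add: positive_def)
  show "countably_additive (sets (symmetrized_measure m)) ?f"
  proof (intro countably_additiveI)
    fix D :: "nat \<Rightarrow> real set"
    assume D: "range D \<subseteq> sets (symmetrized_measure m)" "disjoint_family D"
    have "(\<Sum>i. ?f (D i)) =
        ((\<Sum>i. emeasure m (D i)) + (\<Sum>i. emeasure (distr m borel circle_reflection) (D i))) / 2"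
      by (simp add: ennreal_suminf_divide suminf_add)
    also have "\<dots> = ?f (\<Union> (range D))"
      using D by (simp add: suminf_emeasure assms(1) *)
    finally show "(\<Sum>i. ?f (D i)) = ?f (\<Union> (range D))" .
  qed
  show "A \<in> sets (symmetrized_measure m)"
    using assms * by simp
qed simp

end

theory Submission
  imports Defs
begin

text \<open>
  For fixed \<open>t\<close> only the two projections \<open>P\<close> and \<open>Q' = U Q U\<^sup>*\<close> in a tracial algebra matter.
  Put \<open>A = P + Q' - 1\<close>, \<open>D = P - Q'\<close>, \<open>C = A\<^sup>2 = 1 - D\<^sup>2\<close> and
  \<open>W = (2P - 1)(2Q' - 1)\<close>. Then \<open>C\<close> is central in the algebra generated by \<open>P\<close> and \<open>Q'\<close>,
  \<open>4C = 2 + W + W\<^sup>-\<^sup>1\<close>, and \<open>C\<close> plays the role of \<open>cos\<^sup>2 (\<theta>/2)\<close>. As \<open>A\<close> and \<open>D\<close> anticommute,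
  \<open>\<tau>(C\<^sup>n A) = \<tau>(A) = (\<alpha> + \<beta>)/2\<close>, whence \<open>\<tau>(C\<^sup>n) = 2 \<tau>((PQ')\<^sup>n) - (\<alpha> + \<beta>)/2\<close> for \<open>n \<ge> 1\<close>. The
  recursion \<open>W\<^sup>k\<^sup>+\<^sup>2 = (4C - 2) W\<^sup>k\<^sup>+\<^sup>1 - W\<^sup>k\<close>, which is also that of \<open>cos (k\<theta>)\<close>, turns this into
  the trigonometric moments of the claimed identity, and these determine measures on the circle.
\<close>

section \<open>Signed combinations of finite Borel measures\<close>

text \<open>The weights may be negative, so the Dynkin argument is run on the combination itself.
  Dominated convergence settles closed sets, an intersection-stable generator, and vanishing of the
  combination passes to complements and disjoint unions.\<close>

lemma signed_combination_measure_zero: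
  fixes m :: "'i \<Rightarrow> 'a::metric_space measure" and c :: "'i \<Rightarrow> real"
  assumes "finite I"
    and fin: "\<And>i. i \<in> I \<Longrightarrow> finite_measure (m i)"
    and sets: "\<And>i. i \<in> I \<Longrightarrow> sets (m i) = sets borel"
    and zero: "\<And>f :: 'a \<Rightarrow> real. continuous_on UNIV f \<Longrightarrow> (\<And>x. \<bar>f x\<bar> \<le> 1) \<Longrightarrow>
      (\<Sum>i\<in>I. c i * (LINT x|m i. f x)) = 0"
    and "A \<in> sets borel"
  shows "(\<Sum>i\<in>I. c i * measure (m i) A) = 0"
proof -
  have space: "space (m i) = UNIV" if "i \<in> I" for i
    using sets_eq_imp_space_eq[OF sets[OF that]] by simp
  have closed: "(\<Sum>i\<in>I. c i * measure (m i) K) = 0" if "closed K" for K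
  \<comment> \<open>The empty set is split off because \<open>infdist x {}\<close> is 0, which would
    make the functions below constantly 1.\<close>
  proof (cases "K = {}")
    case False
    \<comment> \<open>Equal to 1 on \<open>K\<close> and, for positive \<open>n\<close>, to 0 at
      distance at least 1/n from \<open>K\<close>.\<close>
    define f where "f n x = max 0 (1 - real n * infdist x K)" for n x
    have f_lim: "(\<lambda>n. f n x) \<longlonglongrightarrow> indicator K x" for x
    proof (cases "x \<in> K")
      case True
      then show ?thesis by (simp add: f_def)
    next
      case out: False
      have pos: "infdist x K > 0"
        using out in_closed_iff_infdist_zero[OF \<open>closed K\<close> False] infdist_nonneg[of x K] by force
      obtain N where N: "1 < real N * infdist x K"
        using reals_Archimedean3[OF pos] by blast
      have "f n x = 0" if "n \<ge> N" for n
      proof -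
        have "real N * infdist x K \<le> real n * infdist x K"
          using that pos by (intro mult_right_mono) simp_all
        then show ?thesis using N by (simp add: f_def)
      qed
      then have "eventually (\<lambda>n. f n x = indicator K x) sequentially"
        using out by (auto simp: eventually_sequentially)
      then show ?thesis by (rule tendsto_eventually)
    qed
    have f_bound: "\<bar>f n x\<bar> \<le> 1" for n x
      using infdist_nonneg[of x K] by (simp add: f_def)
    have f_cont: "continuous_on UNIV (f n)" for n
      unfolding f_def by (intro continuous_intros)
    have "(\<lambda>n. LINT x|m i. f n x) \<longlonglongrightarrow> measure (m i) K" if i: "i \<in> I" for i
    proof -
      interpret finite_measure "m i" by (rule fin[OF i])
      have "(\<lambda>n. LINT x|m i. f n x) \<longlonglongrightarrow> (LINT x|m i. indicator K x)"
      proof (rule integral_dominated_convergence[where w = "\<lambda>_. 1"])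
        show "f n \<in> borel_measurable (m i)" for n
          using borel_measurable_continuous_onI[OF f_cont] measurable_cong_sets[OF sets[OF i] refl]
          by blast
        show "(indicator K :: 'a \<Rightarrow> real) \<in> borel_measurable (m i)"
          using \<open>closed K\<close> sets[OF i] by (intro borel_measurable_indicator) simp
      qed (use f_lim f_bound in simp_all)
      then show ?thesis using space[OF i] by simp
    qed
    then have "(\<lambda>n. \<Sum>i\<in>I. c i * (LINT x|m i. f n x)) \<longlonglongrightarrow> (\<Sum>i\<in>I. c i * measure (m i) K)"
      by (intro tendsto_intros)
    then show ?thesis
      using zero[OF f_cont f_bound] by (simp add: LIMSEQ_const_iff)
  qed simp
  have "Int_stable (Collect closed :: 'a set set)" "Collect closed \<subseteq> Pow (UNIV :: 'a set)"
    "A \<in> sigma_sets UNIV (Collect closed)"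
    using \<open>A \<in> sets borel\<close> by (auto simp: borel_eq_closed Int_stable_def)
  then show ?thesis
  proof (induction rule: sigma_sets_induct_disjoint)
  case (compl B)
    then have B: "B \<in> sets borel" by (simp add: borel_eq_closed)
    have "measure (m i) (UNIV - B) = measure (m i) UNIV - measure (m i) B" if i: "i \<in> I" for i
      using finite_measure.finite_measure_compl[OF fin[OF i], of B] B sets[OF i] space[OF i] by simp
    \<comment> \<open>\<open>UNIV\<close> is closed, so the total masses already cancel.\<close>
    then show ?case
      using compl closed[of UNIV] by (simp add: right_diff_distrib sum_subtractf)
  next
    case (union B)
    then have "range B \<subseteq> sets borel" by (simp add: borel_eq_closed)
    then have "(\<lambda>n. measure (m i) (B n)) sums measure (m i) (\<Union>n. B n)" if "i \<in> I" for i
      using finite_measure.finite_measure_UNION[OF fin[OF that]] union(1) sets[OF that] by simp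
    then have "(\<lambda>n. \<Sum>i\<in>I. c i * measure (m i) (B n)) sums
        (\<Sum>i\<in>I. c i * measure (m i) (\<Union>n. B n))"
      by (intro sums_sum sums_mult)
    then show ?case
      using union(3) by (simp add: sums_iff)
  qed (auto simp: closed)
qed


section \<open>Trigonometric moments on the circle\<close>

text \<open>Generation by monomials and sums lets each property be checked on monomials. The integer
  \<open>k\<close> makes negative frequencies available as well.\<close>

inductive trig_poly :: "(real \<Rightarrow> complex) \<Rightarrow> bool" where
  monomial: "trig_poly (\<lambda>\<theta>. a * cis (real_of_int k * \<theta>))"
| add: "trig_poly f \<Longrightarrow> trig_poly g \<Longrightarrow> trig_poly (\<lambda>\<theta>. f \<theta> + g \<theta>)"

lemma trig_poly_mult:
  assumes "trig_poly f" "trig_poly g"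
  shows "trig_poly (\<lambda>\<theta>. f \<theta> * g \<theta>)"
  using assms(1)
proof induction
  case f: (monomial a k)
  show ?case
    using assms(2)
  proof induction
    case (monomial b l)
    have "(\<lambda>\<theta>. a * cis (real_of_int k * \<theta>) * (b * cis (real_of_int l * \<theta>))) =
        (\<lambda>\<theta>. a * b * cis (real_of_int (k + l) * \<theta>))"
      by (simp add: fun_eq_iff algebra_simps flip: cis_mult)
    then show ?case by (simp only: trig_poly.monomial)
  qed (simp add: distrib_left trig_poly.add)
qed (simp add: distrib_right trig_poly.add)

lemma trig_poly_const: "trig_poly (\<lambda>\<theta>. a)"
  using trig_poly.monomial[of a 0] by simp

text \<open>A real-linear functional of \<open>cis \<theta>\<close> combines cosine and sine, hence
  has frequencies 1 and -1; closure under sums and products does the rest. This links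
  Stone-Weierstrass on the circle with Fourier coefficients.\<close>

lemma trig_poly_real_polynomial_function:
  assumes "real_polynomial_function (g :: complex \<Rightarrow> real)"
  shows "trig_poly (\<lambda>\<theta>. complex_of_real (g (cis \<theta>)))"
  using assms
proof induction
  case (linear f)
  interpret bounded_linear f by fact
  have *: "f (cis \<theta>) = cos \<theta> * f 1 + sin \<theta> * f \<i>" for \<theta>
  proof -
    have "cis \<theta> = cos \<theta> *\<^sub>R 1 + sin \<theta> *\<^sub>R \<i>"
      by (simp add: complex_eq_iff)
    then show ?thesis by (simp add: add scaleR)
  qed
  \<comment> \<open>The two coefficients come from Euler's formulas for cosine and sine.\<close>
  have "(\<lambda>\<theta>. complex_of_real (f (cis \<theta>))) =
      (\<lambda>\<theta>. (f 1 - \<i> * f \<i>) / 2 * cis (real_of_int 1 * \<theta>) + (f 1 + \<i> * f \<i>) / 2 * cis (real_of_int (- 1) * \<theta>))"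
    unfolding * by (auto simp: fun_eq_iff complex_eq_iff field_simps)
  then show ?case
    by (simp only: trig_poly.intros)
qed (simp_all add: trig_poly_const trig_poly.add trig_poly_mult)

lemma continuous_on_trig_poly: "trig_poly f \<Longrightarrow> continuous_on S f"
  by (induction rule: trig_poly.induct) (auto intro!: continuous_intros)

lemma bounded_trig_poly: "trig_poly f \<Longrightarrow> \<exists>K. \<forall>\<theta>. norm (f \<theta>) \<le> K"
proof (induction rule: trig_poly.induct)
  case (monomial a k)
  then show ?case by (auto simp: norm_mult)
next
  case (add f g)
  then show ?case by (meson norm_triangle_le add_mono)
qed

lemma integrable_trig_poly:
  assumes "finite_measure m" "sets m = sets borel" "trig_poly f"
  shows "integrable m f"
proof -
  interpret finite_measure m by fact
  obtain K where "\<forall>\<theta>. norm (f \<theta>) \<le> K"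
    using bounded_trig_poly assms by blast
  moreover have "f \<in> borel_measurable m"
    using borel_measurable_continuous_onI[OF continuous_on_trig_poly[OF assms(3)]]
      measurable_cong_sets[OF assms(2) refl] by blast
  ultimately show ?thesis
    by (intro integrable_const_bound[where B = K]) auto
qed

lemma integral_cis_minus:
  fixes m :: "real measure"
  shows "(LINT \<theta>|m. cis (- (x * \<theta>))) = cnj (LINT \<theta>|m. cis (x * \<theta>))"
  by (simp only: cis_cnj flip: Bochner_Integration.integral_cnj)

text \<open>Nonnegative frequencies suffice: the weights are real, so conjugating the hypothesis
  yields the negative ones. This matches \<open>circle_spectral_measure\<close>, which prescribes
  only nonnegative powers.\<close>

lemma signed_combination_trig_poly_zero:
  fixes m :: "'i \<Rightarrow> real measure" and c :: "'i \<Rightarrow> real" and f :: "real \<Rightarrow> complex"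
  assumes fin: "\<And>i. i \<in> I \<Longrightarrow> finite_measure (m i)"
    and sets: "\<And>i. i \<in> I \<Longrightarrow> sets (m i) = sets borel"
    and zero: "\<And>k::nat. (\<Sum>i\<in>I. c i * (LINT \<theta>|m i. cis (real k * \<theta>))) = 0"
    and "trig_poly f"
  shows "(\<Sum>i\<in>I. c i * (LINT \<theta>|m i. f \<theta>)) = 0"
  using \<open>trig_poly f\<close>
proof induction
  case (monomial a k)
  have "(\<Sum>i\<in>I. c i * (LINT \<theta>|m i. cis (real_of_int k * \<theta>))) = 0"
  proof (cases k)
    case (nonneg n)
    then show ?thesis using zero[of n] by simp
  next
    case (neg n)
    \<comment> \<open>In this case \<open>k\<close> is \<open>- (n + 1)\<close>, hence the
      \<open>Suc n\<close>.\<close>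
    have "(\<Sum>i\<in>I. c i * (LINT \<theta>|m i. cis (real_of_int k * \<theta>))) =
        cnj (\<Sum>i\<in>I. c i * (LINT \<theta>|m i. cis (real (Suc n) * \<theta>)))"
      unfolding cnj_sum complex_cnj_mult integral_cis_minus[symmetric] using neg
      by (simp del: of_nat_Suc)
    then show ?thesis by (simp only: zero) simp
  qed
  then have "a * (\<Sum>i\<in>I. c i * (LINT \<theta>|m i. cis (real_of_int k * \<theta>))) = 0" by simp
  then show ?case
    by (simp add: sum_distrib_left mult_ac)
next
  case (add f g)
  have "(LINT \<theta>|m i. f \<theta> + g \<theta>) = (LINT \<theta>|m i. f \<theta>) + (LINT \<theta>|m i. g \<theta>)" if "i \<in> I" for i
    using add that by (intro Bochner_Integration.integral_add integrable_trig_poly fin sets)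
  then show ?case
    using add by (simp add: distrib_left sum.distrib)
qed

text \<open>\<open>Arg\<close> is continuous off the nonpositive real axis, and on that axis it is
  pi except at 0; the pieces are glued.\<close>

lemma borel_measurable_Arg: "Arg \<in> borel_measurable borel"
proof -
  have meas: "{z :: complex. z \<in> \<real>\<^sub>\<le>\<^sub>0} \<in> sets borel"
    using closed_nonpos_Reals_complex by (simp add: borel_closed)
  have "(\<lambda>z. if z \<in> - \<real>\<^sub>\<le>\<^sub>0 then Arg z else 0) \<in> borel_measurable borel"
    using meas by (intro borel_measurable_continuous_on_if continuous_on_Arg) auto
  then have "(\<lambda>z. if z \<in> \<real>\<^sub>\<le>\<^sub>0 then (if z = 0 then 0 else pi)
      else if z \<in> - \<real>\<^sub>\<le>\<^sub>0 then Arg z else 0) \<in> borel_measurable borel"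
    using meas by measurable
  also have "(\<lambda>z. if z \<in> \<real>\<^sub>\<le>\<^sub>0 then (if z = 0 then 0 else pi)
      else if z \<in> - \<real>\<^sub>\<le>\<^sub>0 then Arg z else 0) = Arg"
  proof
    fix z :: complex
    have "Arg z = pi" if "z \<in> \<real>\<^sub>\<le>\<^sub>0" "z \<noteq> 0"
      using that unfolding Arg_eq_pi by (auto simp: complex_nonpos_Reals_iff complex_eq_iff)
    then show "(if z \<in> \<real>\<^sub>\<le>\<^sub>0 then (if z = 0 then 0 else pi)
        else if z \<in> - \<real>\<^sub>\<le>\<^sub>0 then Arg z else 0) = Arg z"
      by (auto simp: Arg_zero)
  qed
  finally show ?thesis .
qed

text \<open>The half-open interval is not compact, so the measures are pushed forward by
  \<open>cis\<close> to the unit circle. There, by Stone-Weierstrass, trigonometric moments control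
  the integrals of all continuous functions. \<open>Arg\<close> carries the result back.\<close>

lemma signed_combination_circle_zero:
  fixes m :: "'i \<Rightarrow> real measure" and c :: "'i \<Rightarrow> real"
  assumes "finite I"
    and fin: "\<And>i. i \<in> I \<Longrightarrow> finite_measure (m i)"
    and sets: "\<And>i. i \<in> I \<Longrightarrow> sets (m i) = sets borel"
    and range: "\<And>i. i \<in> I \<Longrightarrow> AE \<theta> in m i. \<theta> \<in> {- pi<..pi}"
    and zero: "\<And>k::nat. (\<Sum>i\<in>I. c i * (LINT \<theta>|m i. cis (real k * \<theta>))) = 0"
    and A: "A \<in> sets borel"
  shows "(\<Sum>i\<in>I. c i * measure (m i) A) = 0"
proof -
  have cis: "cis \<in> measurable (m i) borel" if "i \<in> I" for i
    unfolding measurable_cong_sets[OF sets[OF that] refl]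
    by (intro borel_measurable_continuous_onI continuous_intros)
  have space: "space (m i) = UNIV" if "i \<in> I" for i
    using sets_eq_imp_space_eq[OF sets[OF that]] by simp
  \<comment> \<open>A bound for the total variation of the combination, by which the uniform
    approximation error gets multiplied.\<close>
  define C where "C = (\<Sum>i\<in>I. \<bar>c i\<bar> * measure (m i) UNIV)"
  have "(\<Sum>i\<in>I. c i * measure (distr (m i) borel cis) (Arg -` A)) = 0"
  proof (rule signed_combination_measure_zero[OF \<open>finite I\<close>])
    show "Arg -` A \<in> sets borel"
      using measurable_sets[OF borel_measurable_Arg A] by simp
    show "finite_measure (distr (m i) borel cis)" if "i \<in> I" for i
      by (rule finite_measure.finite_measure_distr[OF fin[OF that] cis[OF that]])
    fix f :: "complex \<Rightarrow> real"
    assume cont: "continuous_on UNIV f" and bound: "\<And>x. \<bar>f x\<bar> \<le> 1"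
    let ?L = "\<lambda>f. \<Sum>i\<in>I. c i * (LINT \<theta>|m i. f (cis \<theta>))"
    have "\<bar>?L f\<bar> \<le> e * C" if "e > 0" for e
    proof -
      \<comment> \<open>Approximation on the circle alone suffices, since only the values at
        \<open>cis \<theta>\<close> are integrated.\<close>
      obtain g where g: "real_polynomial_function g" "\<And>z. z \<in> sphere 0 1 \<Longrightarrow> \<bar>f z - g z\<bar> < e"
        using Stone_Weierstrass_real_polynomial_function[OF compact_sphere _ \<open>e > 0\<close>]
          continuous_on_subset[OF cont subset_UNIV] by metis
      have trig: "trig_poly (\<lambda>\<theta>. complex_of_real (g (cis \<theta>)))"
        by (rule trig_poly_real_polynomial_function[OF g(1)])
      have "complex_of_real (?L g) = 0"
        using signed_combination_trig_poly_zero[OF fin sets zero trig] by simp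
      then have "?L g = 0" by (simp only: of_real_eq_0_iff)
      have diff: "\<bar>(LINT \<theta>|m i. f (cis \<theta>)) - (LINT \<theta>|m i. g (cis \<theta>))\<bar> \<le> e * measure (m i) UNIV"
        if i: "i \<in> I" for i
      proof -
        interpret finite_measure "m i" by (rule fin[OF i])
        have f: "integrable (m i) (\<lambda>\<theta>. f (cis \<theta>))"
        proof (rule integrable_const_bound[where B = 1])
          show "(\<lambda>\<theta>. f (cis \<theta>)) \<in> borel_measurable (m i)"
            using measurable_compose[OF cis[OF i] borel_measurable_continuous_onI[OF cont]] .
        qed (simp add: bound)
        have g': "integrable (m i) (\<lambda>\<theta>. g (cis \<theta>))"
          using integrable_Re[OF integrable_trig_poly[OF fin[OF i] sets[OF i] trig]] by simp
        have "\<bar>(LINT \<theta>|m i. f (cis \<theta>)) - (LINT \<theta>|m i. g (cis \<theta>))\<bar> =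
            \<bar>LINT \<theta>|m i. f (cis \<theta>) - g (cis \<theta>)\<bar>"
          using f g' by simp
        also have "\<dots> \<le> (LINT \<theta>|m i. \<bar>f (cis \<theta>) - g (cis \<theta>)\<bar>)"
          by (rule integral_abs_bound)
        also have "\<dots> \<le> (LINT \<theta>|m i. e)"
          using f g' g(2) by (intro integral_mono) (auto intro: less_imp_le)
        finally show ?thesis by (simp add: space[OF i] mult.commute)
      qed
      have "?L f = ?L f - ?L g" using \<open>?L g = 0\<close> by simp
      also have "\<dots> = (\<Sum>i\<in>I. c i * ((LINT \<theta>|m i. f (cis \<theta>)) - (LINT \<theta>|m i. g (cis \<theta>))))"
        by (simp add: right_diff_distrib sum_subtractf)
      also have "\<bar>\<dots>\<bar> \<le> (\<Sum>i\<in>I. \<bar>c i\<bar> * (e * measure (m i) UNIV))"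
        using diff by (intro order_trans[OF sum_abs] sum_mono) (auto simp: abs_mult intro: mult_left_mono)
      also have "\<dots> = e * C"
        by (simp add: C_def sum_distrib_left mult_ac)
      finally show ?thesis .
    qed
    moreover have "C \<ge> 0" by (simp add: C_def sum_nonneg)
    ultimately have "\<bar>?L f\<bar> \<le> e" if "e > 0" for e
    proof -
      \<comment> \<open>Dividing by \<open>C + 1\<close> also covers \<open>C = 0\<close>.\<close>
      have "\<bar>?L f\<bar> \<le> e / (C + 1) * C"
        using \<open>\<And>e. e > 0 \<Longrightarrow> \<bar>?L f\<bar> \<le> e * C\<close>[of "e / (C + 1)"] that \<open>C \<ge> 0\<close> by simp
      also have "\<dots> \<le> e" using that \<open>C \<ge> 0\<close> by (simp add: field_simps)
      finally show ?thesis .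
    qed
    then have "?L f = 0"
      using field_le_epsilon[of "\<bar>?L f\<bar>" 0] by simp
    then show "(\<Sum>i\<in>I. c i * (LINT z|distr (m i) borel cis. f z)) = 0"
      using borel_measurable_continuous_onI[OF cont] cis by (simp add: integral_distr)
  qed simp
  moreover have "measure (distr (m i) borel cis) (Arg -` A) = measure (m i) A" if i: "i \<in> I" for i
  proof -
    have meas: "Arg -` A \<in> sets borel"
      using measurable_sets[OF borel_measurable_Arg A] by simp
    have "measure (distr (m i) borel cis) (Arg -` A) = measure (m i) (cis -` (Arg -` A))"
      using measure_distr[OF cis[OF i] meas] space[OF i] by simp
    also have "\<dots> = measure (m i) A"
    proof (rule measure_eq_AE)
      \<comment> \<open>\<open>Arg\<close> inverts \<open>cis\<close> only on the interval that
        carries \<open>m i\<close>, so the two sets agree only almost everywhere.\<close>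
      show "AE \<theta> in m i. (\<theta> \<in> cis -` Arg -` A) = (\<theta> \<in> A)"
        using range[OF i] by eventually_elim (simp add: Arg_cis)
      show "cis -` Arg -` A \<in> sets (m i)"
        using measurable_sets[OF cis[OF i] meas] space[OF i] by simp
    qed (use A sets[OF i] in simp)
    finally show ?thesis .
  qed
  ultimately show ?thesis by simp
qed


section \<open>Traces of products of two projections\<close>

text \<open>\<open>adj\<close> is a definite description, so exhibiting one adjoint determines it
  once uniqueness is known: at each vector the difference of two adjoints is orthogonal to
  itself.\<close>

lemma adj_eqI:
  assumes "is_adjoint S T"
  shows "adj T = S"
  unfolding adj_def
proof (rule the_equality[where P = "\<lambda>S. is_adjoint S T", OF assms])
  fix S' assume S': "is_adjoint S' T"
  have "app S' x = app S x" for x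
  proof -
    let ?y = "app S' x - app S x"
    have "cinner (app S' x) ?y = cinner (app S x) ?y"
      using assms S' by (simp add: is_adjoint_def)
    then have "cinner ?y (app S' x) = cinner ?y (app S x)"
      by (metis cinner_commute)
    then have "cinner ?y ?y = 0"
      using cinner_add_right[of ?y ?y "app S x"] by simp
    then show ?thesis by (simp add: cinner_norm)
  qed
  then show "S' = S" by (simp add: app_inject[symmetric] fun_eq_iff)
qed

lemma commutant_antimono: "X \<subseteq> Y \<Longrightarrow> commutant Y \<subseteq> commutant X"
  by (auto simp: commutant_def)

text \<open>Integer scalars are turned into repeated sums so that later identities are pure ring
  identities.\<close>

lemma scaleC_two_bop: "2 *\<^sub>C T = T + (T :: 'h::complex_hilbert_space bop)"
proof transfer
  fix f :: "'h \<Rightarrow> 'h"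
  show "(\<lambda>x. 2 *\<^sub>C f x) = (\<lambda>x. f x + f x)"
    using scaleC_add_left[of 1 1 "f x" for x] scaleR_scaleC[of 1 "f x" for x, symmetric]
    by (auto simp: fun_eq_iff)
qed

lemma scaleC_minus_one_bop: "(- 1) *\<^sub>C T = - (T :: 'h::complex_hilbert_space bop)"
proof transfer
  fix f :: "'h \<Rightarrow> 'h"
  show "(\<lambda>x. (- 1) *\<^sub>C f x) = (\<lambda>x. - f x)"
    using scaleR_scaleC[of "- 1", symmetric] by (auto simp: fun_eq_iff)
qed

section \<open>Closure of the von Neumann algebra under the algebraic operations\<close>

context wstar_probability_space
begin

lemma M_bicommutant: "commutant (commutant M) = M"
  using von_neumann by (simp add: von_neumann_algebra_def)

text \<open>As \<open>M\<close> is its own bicommutant, membership is a commutation condition, from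
  which closure under sums and products is immediate.\<close>

lemma mem_M_iff: "T \<in> M \<longleftrightarrow> (\<forall>S \<in> commutant M. T * S = S * T)"
  using M_bicommutant by (auto simp: commutant_def)

lemma one_mem: "1 \<in> M"
  by (simp add: mem_M_iff)

lemma add_mem: "S \<in> M \<Longrightarrow> T \<in> M \<Longrightarrow> S + T \<in> M"
  by (simp add: mem_M_iff algebra_simps)

lemma uminus_mem: "T \<in> M \<Longrightarrow> - T \<in> M"
  by (simp add: mem_M_iff)

lemma diff_mem: "S \<in> M \<Longrightarrow> T \<in> M \<Longrightarrow> S - T \<in> M"
  by (simp add: mem_M_iff algebra_simps)

lemma mult_mem: "S \<in> M \<Longrightarrow> T \<in> M \<Longrightarrow> S * T \<in> M"
  by (simp add: mem_M_iff) (metis mult.assoc)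

lemma power_mem: "T \<in> M \<Longrightarrow> T ^ n \<in> M"
  by (induction n) (simp_all add: one_mem mult_mem)

lemma adj_mem: "T \<in> M \<Longrightarrow> adj T \<in> M"
  using von_neumann adj_eqI by (force simp: von_neumann_algebra_def)

lemma vN_generated_subset:
  assumes "X \<subseteq> M"
  shows "vN_generated X \<subseteq> M"
proof -
  have "X \<union> adj ` X \<subseteq> M" using assms adj_mem by auto
  then have "commutant (commutant (X \<union> adj ` X)) \<subseteq> commutant (commutant M)"
    by (intro commutant_antimono)
  then show ?thesis by (simp add: vN_generated_def M_bicommutant)
qed

lemmas mem_simps = one_mem add_mem uminus_mem diff_mem mult_mem power_mem

lemma trace_uminus: "T \<in> M \<Longrightarrow> \<tau> (- T) = - \<tau> T"
  using trace_scaleC[of T "- 1"] by (simp add: scaleC_minus_one_bop)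

lemma trace_diff: "S \<in> M \<Longrightarrow> T \<in> M \<Longrightarrow> \<tau> (S - T) = \<tau> S - \<tau> T"
  using trace_add[of S "- T"] by (simp add: trace_uminus uminus_mem)

end

section \<open>Trace identities for a pair of idempotents\<close>

locale two_idempotents = wstar_probability_space +
  fixes P Q
  assumes P: "P \<in> M" "P * P = P" and Q: "Q \<in> M" "Q * Q = Q"
begin

text \<open>With the reflections \<open>R = 2P - 1\<close> and \<open>S = 2Q - 1\<close>,
  \<open>A\<close> and \<open>D\<close> are half of \<open>R + S\<close> and half of
  \<open>R - S\<close>. Since both reflections square to 1, \<open>A\<close> and \<open>D\<close>
  anticommute and their squares sum to 1.\<close>

definition "A = P + Q - 1"
definition "D = P - Q"
definition "C = A * A"
definition "W = (P + P - 1) * (Q + Q - 1)"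

lemma mem: "A \<in> M" "D \<in> M" "C \<in> M" "W \<in> M"
  unfolding A_def D_def C_def W_def by (simp_all add: P Q mem_simps)

lemma idem_left: "P * (P * X) = P * X" "Q * (Q * X) = Q * X"
  by (simp_all add: P Q flip: mult.assoc)

lemma AP: "A * P = Q * P" and AQ: "A * Q = P * Q"
  and PA: "P * A = P * Q" and QA: "Q * A = Q * P"
  by (simp_all add: A_def algebra_simps P Q)

lemma CP: "C * P = P * (Q * P)" and PC: "P * C = P * (Q * P)"
  and CQ: "C * Q = Q * (P * Q)" and QC: "Q * C = Q * (P * Q)"
  by (simp_all add: C_def A_def algebra_simps P Q idem_left)

lemma pow_C_commute:
  assumes "C * X = X * C"
  shows "C ^ n * X = X * C ^ n"
  using assms by (induction n) (simp_all add: mult.assoc, metis mult.assoc)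

lemma CA: "C * A = A * C"
  by (simp add: C_def mult.assoc)

lemma CD: "C * D = D * C"
  using CP PC CQ QC by (simp add: D_def algebra_simps)

lemma DD: "D * D = 1 - C"
  by (simp add: C_def A_def D_def algebra_simps P Q)

lemma AD: "A * D = - (D * A)"
  by (simp add: A_def D_def algebra_simps P Q)

text \<open>\<open>?W'\<close> inverts \<open>W\<close> because each reflection squares to 1; the
  sum \<open>W + ?W'\<close>, which is \<open>4C - 2\<close>, is multiplied by
  \<open>W ^ Suc k\<close>.\<close>

lemma W_pow_rec: "W ^ Suc (Suc k) = C * W ^ Suc k + C * W ^ Suc k + C * W ^ Suc k + C * W ^ Suc k
    - W ^ Suc k - W ^ Suc k - W ^ k"
proof -
  let ?W' = "(Q + Q - 1) * (P + P - 1)"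
  have inv: "?W' * W = 1"
    by (simp add: W_def algebra_simps P Q idem_left)
  have sum: "W + ?W' = C + C + C + C - 1 - 1"
    by (simp add: W_def C_def A_def algebra_simps P Q)
  have "(W + ?W') * W ^ Suc k = W ^ Suc (Suc k) + (?W' * W) * W ^ k"
    by (simp only: distrib_right power_Suc mult.assoc)
  then have "W ^ Suc (Suc k) = (W + ?W') * W ^ Suc k - W ^ k"
    unfolding inv by simp
  then show ?thesis
    unfolding sum by (simp only: left_diff_distrib distrib_right mult_1_left)
qed

text \<open>
  Moving one \<open>D\<close> around the trace and anticommuting it with \<open>A\<close> shows that
  \<open>\<tau>(C\<^sup>n A D\<^sup>2) = - \<tau>(C\<^sup>n A D\<^sup>2)\<close>, so the factor \<open>C = 1 - D\<^sup>2\<close> can be dropped.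
\<close>

lemma trace_pow_C_A: "\<tau> (C ^ n * A) = \<tau> A"
proof (induction n)
  case (Suc n)
  have comm: "C ^ n * A = A * C ^ n" "C ^ n * D = D * C ^ n"
    by (rule pow_C_commute[OF CA], rule pow_C_commute[OF CD])
  have "\<tau> (C ^ n * A * D * D) = - \<tau> (C ^ n * D * A * D)"
    using AD by (simp add: mult.assoc flip: trace_uminus add: mem mem_simps)
  also have "\<tau> (C ^ n * D * A * D) = \<tau> (D * (C ^ n * D * A))"
    by (rule trace_commute) (simp_all add: mem mem_simps)
  also have "D * (C ^ n * D * A) = C ^ n * (D * D) * A"
    by (metis comm(2) mult.assoc)
  \<comment> \<open>\<open>D * D\<close> is \<open>1 - C\<close> and so commutes with
    \<open>A\<close>; the initial word is back with the opposite sign.\<close>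
  also have "\<dots> = C ^ n * A * D * D"
    unfolding DD mult.assoc using CA by (simp add: algebra_simps DD)
  finally have "\<tau> (C ^ n * A * D * D) = 0" by simp
  moreover have "C ^ Suc n * A = C ^ n * A - C ^ n * A * D * D"
    unfolding power_Suc2 mult.assoc DD using CA by (simp add: algebra_simps)
  ultimately show ?case
    using Suc by (simp add: trace_diff mem mem_simps del: power_Suc)
qed simp

text \<open>Since \<open>(P * Q) ^ n * P = C ^ n * P\<close> and \<open>A * Q = P * A\<close>,
  cyclicity gives \<open>C ^ n * P\<close> and \<open>C ^ n * Q\<close> the trace of
  \<open>(P * Q) ^ n\<close>; then \<open>C ^ n * A\<close> is expanded. At \<open>n = 0\<close> the
  right-hand side would be \<open>2 - \<tau> A\<close> instead of 1.\<close>

lemma trace_pow_C: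
  assumes "n \<ge> 1"
  shows "\<tau> (C ^ n) = 2 * \<tau> ((P * Q) ^ n) - \<tau> A"
proof -
  obtain l where n: "n = Suc l" using assms by (cases n) auto
  have pow: "(P * Q) ^ n * P = C ^ n * P" for n
  proof (induction n)
    case (Suc n)
    have "(P * Q) ^ Suc n * P = P * Q * (C ^ n * P)"
      using Suc by (simp add: mult.assoc)
    also have "\<dots> = P * Q * (P * C ^ n)"
      using pow_C_commute[of P n] CP PC by simp
    also have "\<dots> = C * P * C ^ n"
      by (simp add: CP mult.assoc)
    also have "\<dots> = C ^ Suc n * P"
      using pow_C_commute[of P n] CP PC by (metis mult.assoc power_Suc)
    finally show ?case .
  qed simp
  have "P * (P * Q) ^ n = (P * Q) ^ n"
    by (simp add: n mult.assoc idem_left)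
  then have "\<tau> ((P * Q) ^ n) = \<tau> ((P * Q) ^ n * P)"
    using trace_commute[of P "(P * Q) ^ n"] by (simp add: P Q mem_simps)
  then have traceP: "\<tau> (C ^ n * P) = \<tau> ((P * Q) ^ n)" by (simp add: pow)
  have "C ^ n * Q = C ^ l * A * P * A"
    unfolding n power_Suc2 by (simp add: C_def mult.assoc AQ PA)
  then have "\<tau> (C ^ n * Q) = \<tau> (A * (C ^ l * A * P))"
    using trace_commute[of A "C ^ l * A * P"] by (simp add: P mem mem_simps)
  also have "A * (C ^ l * A * P) = C ^ n * P"
    unfolding n power_Suc2 using pow_C_commute[OF CA, of l] by (simp add: C_def) (metis mult.assoc)
  finally have traceQ: "\<tau> (C ^ n * Q) = \<tau> (C ^ n * P)" .
  have "\<tau> A = \<tau> (C ^ n * P + C ^ n * Q - C ^ n)"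
    unfolding trace_pow_C_A[of n, symmetric] by (simp add: A_def algebra_simps)
  also have "\<dots> = 2 * \<tau> ((P * Q) ^ n) - \<tau> (C ^ n)"
    by (simp add: trace_add trace_diff mem_simps mem P Q traceQ traceP)
  finally show ?thesis by simp
qed

text \<open>By cyclicity \<open>W\<close> and its inverse have the same trace against
  \<open>C ^ n\<close>, and their sum is \<open>4C - 2\<close>. This is the operator form of the
  half-angle formula for the cosine.\<close>

lemma trace_pow_C_W: "\<tau> (C ^ n * W) = 2 * \<tau> (C ^ Suc n) - \<tau> (C ^ n)"
proof -
  let ?R = "P + P - 1" and ?S = "Q + Q - 1"
  have sum: "C + C + C + C = W + ?S * ?R + 1 + 1"
    by (simp add: W_def C_def A_def algebra_simps P Q)
  have CR: "C ^ n * ?R = ?R * C ^ n"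
    using CP PC by (intro pow_C_commute) (simp add: algebra_simps)
  have "\<tau> (C ^ n * (?S * ?R)) = \<tau> (C ^ n * ?S * ?R)"
    by (simp add: mult.assoc)
  also have "\<dots> = \<tau> (?R * (C ^ n * ?S))"
    by (rule trace_commute) (simp_all add: mem mem_simps P Q)
  also have "?R * (C ^ n * ?S) = C ^ n * W"
    using CR by (simp add: W_def flip: mult.assoc)
  finally have *: "\<tau> (C ^ n * (?S * ?R)) = \<tau> (C ^ n * W)" .
  have "C ^ n * (C + C + C + C) = C ^ n * W + C ^ n * (?S * ?R) + C ^ n + C ^ n"
    unfolding sum by (simp only: distrib_left mult_1_right)
  then have "\<tau> (C ^ Suc n + C ^ Suc n + C ^ Suc n + C ^ Suc n) =
      \<tau> (C ^ n * W + C ^ n * (?S * ?R) + C ^ n + C ^ n)"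
    by (simp only: distrib_left power_Suc2)
  then have "4 * \<tau> (C ^ Suc n) = 2 * \<tau> (C ^ n * W) + 2 * \<tau> (C ^ n)"
    by (simp add: trace_add mem mem_simps P Q * del: power_Suc)
  then have "2 * \<tau> (C ^ n * W) = 2 * (2 * \<tau> (C ^ Suc n) - \<tau> (C ^ n))"
    by (simp add: algebra_simps del: power_Suc)
  then show ?thesis by (simp only: mult_cancel_left) simp
qed

text \<open>
  The term \<open>0 ^ n\<close> is the atom at \<open>\<pi>\<close>, where \<open>cos\<^sup>2 (\<theta>/2)\<close> vanishes. The powers of \<open>C\<close> are carried
  along because the recursion for \<open>W ^ k\<close> produces them.
\<close>

lemma trace_pow_C_pow_W:
  fixes a :: real
  assumes A: "\<tau> A = complex_of_real a"
    and \<mu>: "interval_spectral_measure \<tau> (P * Q) \<mu>"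
  shows "\<tau> (C ^ n * W ^ k) = complex_of_real
    (2 * (LINT x|\<mu>. x ^ n * cos (k * (2 * arccos (sqrt x)))) - (1 - a) * 0 ^ n * (- 1) ^ k - a)"
proof -
  interpret prob_space \<mu>
    using \<mu> by (simp add: interval_spectral_measure_def)
  have sets: "sets \<mu> = sets borel" and range: "AE x in \<mu>. x \<in> {0..1}"
    and moments: "\<And>n. n \<ge> 1 \<Longrightarrow> \<tau> ((P * Q) ^ n) = complex_of_real (LINT x|\<mu>. x ^ n)"
    using \<mu> by (simp_all add: interval_spectral_measure_def)
  define \<phi> where "\<phi> x = 2 * arccos (sqrt x)" for x
  have int: "integrable \<mu> (\<lambda>x. x ^ n * cos (real k * \<phi> x))" for n k
  proof (rule integrable_const_bound[where B = 1])
    have "\<phi> \<in> borel_measurable \<mu>"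
      unfolding measurable_cong_sets[OF sets refl] \<phi>_def by (rule measurable_angle)
    moreover have "(\<lambda>x. x) \<in> borel_measurable \<mu>"
      unfolding measurable_cong_sets[OF sets refl] by simp
    ultimately show "(\<lambda>x. x ^ n * cos (real k * \<phi> x)) \<in> borel_measurable \<mu>"
      by measurable
    show "AE x in \<mu>. norm (x ^ n * cos (real k * \<phi> x)) \<le> 1"
      using range by eventually_elim (auto simp: abs_mult intro!: mult_le_one power_le_one)
  qed
  have cos_phi: "cos (\<phi> x) = 2 * x - 1" if "x \<in> {0..1}" for x
  proof -
    have "- 1 \<le> sqrt x" by (rule order_trans[of _ 0]) (use that in simp_all)
    then have "cos (arccos (sqrt x)) = sqrt x" using that by (intro cos_arccos) simp_all
    then show ?thesis using that unfolding \<phi>_def cos_double_cos by simp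
  qed
  define F where "F n k = (LINT x|\<mu>. x ^ n * cos (real k * \<phi> x))" for n k
  \<comment> \<open>Counterpart of \<open>trace_pow_C_W\<close>. The formula for
    \<open>cos (\<phi> x)\<close> needs \<open>x\<close> in [0,1], so the integrands agree only
    almost everywhere.\<close>
  have F1: "F n 1 = 2 * F (Suc n) 0 - F n 0" for n
  proof -
    have "F n 1 = (LINT x|\<mu>. 2 * (x ^ Suc n * cos (real 0 * \<phi> x)) - x ^ n * cos (real 0 * \<phi> x))"
      unfolding F_def
    proof (intro integral_cong_AE borel_measurable_integrable Bochner_Integration.integrable_diff
        integrable_mult_right int)
      show "AE x in \<mu>. x ^ n * cos (real 1 * \<phi> x) =
          2 * (x ^ Suc n * cos (real 0 * \<phi> x)) - x ^ n * cos (real 0 * \<phi> x)"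
        using range by eventually_elim (simp add: cos_phi algebra_simps)
    qed
    also have "\<dots> = 2 * F (Suc n) 0 - F n 0"
      unfolding F_def using int[of "Suc n" 0] int[of n 0] by (simp del: power_Suc)
    finally show ?thesis .
  qed
  \<comment> \<open>Counterpart of \<open>W_pow_rec\<close>, with \<open>4x - 2\<close> equal to
    \<open>2 * cos (\<phi> x)\<close>.\<close>
  have F2: "F n (Suc (Suc k)) = 4 * F (Suc n) (Suc k) - 2 * F n (Suc k) - F n k" for n k
  proof -
    have cos2: "cos (real (Suc (Suc k)) * \<phi> x) =
        2 * cos (\<phi> x) * cos (real (Suc k) * \<phi> x) - cos (real k * \<phi> x)" for x
    proof -
      have "real (Suc (Suc k)) * \<phi> x = real (Suc k) * \<phi> x + \<phi> x"
        "real k * \<phi> x = real (Suc k) * \<phi> x - \<phi> x"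
        by (simp_all add: algebra_simps)
      then show ?thesis by (simp only: cos_add cos_diff) simp
    qed
    have "F n (Suc (Suc k)) = (LINT x|\<mu>. 4 * (x ^ Suc n * cos (real (Suc k) * \<phi> x))
        - 2 * (x ^ n * cos (real (Suc k) * \<phi> x)) - x ^ n * cos (real k * \<phi> x))"
      unfolding F_def
    proof (intro integral_cong_AE borel_measurable_integrable Bochner_Integration.integrable_diff
        integrable_mult_right int)
      show "AE x in \<mu>. x ^ n * cos (real (Suc (Suc k)) * \<phi> x) =
          4 * (x ^ Suc n * cos (real (Suc k) * \<phi> x))
          - 2 * (x ^ n * cos (real (Suc k) * \<phi> x)) - x ^ n * cos (real k * \<phi> x)"
        using range unfolding cos2 by eventually_elim (simp add: cos_phi algebra_simps del: of_nat_Suc)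
    qed
    also have "\<dots> = 4 * F (Suc n) (Suc k) - 2 * F n (Suc k) - F n k"
      unfolding F_def using int
      by (subst Bochner_Integration.integral_diff; (subst Bochner_Integration.integral_diff)?)
        (auto simp del: power_Suc of_nat_Suc)
    finally show ?thesis .
  qed
  \<comment> \<open>At \<open>n = 0\<close> the right-hand side is
    \<open>2 - (1 - a) - a = 1\<close>, which is why the atom term is needed.\<close>
  have C0: "\<tau> (C ^ n) = complex_of_real (2 * F n 0 - (1 - a) * 0 ^ n - a)" for n
  proof (cases n)
    case 0
    then show ?thesis by (simp add: F_def prob_space trace_one)
  next
    case (Suc l)
    then show ?thesis
      using trace_pow_C[of n] moments[of n] by (simp add: F_def A)
  qed
  have "\<tau> (C ^ n * W ^ k) = complex_of_real (2 * F n k - (1 - a) * 0 ^ n * (- 1) ^ k - a)"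
  proof (induction k arbitrary: n rule: induct_nat_012)
    case 0
    then show ?case using C0 by simp
  next
    case 1
    have "\<tau> (C ^ n * W ^ Suc 0) = 2 * \<tau> (C ^ Suc n) - \<tau> (C ^ n)"
      using trace_pow_C_W by simp
    also have "\<dots> = complex_of_real (2 * F n (Suc 0) - (1 - a) * 0 ^ n * (- 1) ^ Suc 0 - a)"
      using F1[of n] by (simp add: C0 del: power_Suc)
    finally show ?case .
  next
    case (ge2 k)
    let ?X = "C ^ n * W ^ Suc k" and ?Y = "C ^ Suc n * W ^ Suc k"
    have "C ^ n * W ^ Suc (Suc k) = ?Y + ?Y + ?Y + ?Y - ?X - ?X - C ^ n * W ^ k"
      unfolding W_pow_rec power_Suc2[of C] by (simp only: right_diff_distrib distrib_left mult.assoc)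
    moreover have "?X \<in> M" "?Y \<in> M" "C ^ n * W ^ k \<in> M"
      by (intro mult_mem power_mem mem)+
    ultimately have "\<tau> (C ^ n * W ^ Suc (Suc k)) = 4 * \<tau> ?Y - 2 * \<tau> ?X - \<tau> (C ^ n * W ^ k)"
      by (simp only: trace_add trace_diff add_mem diff_mem) simp
    \<comment> \<open>The correction terms satisfy the same recursion: at the atom pi the factor
      \<open>4 * 0 ^ Suc n\<close> vanishes and
      \<open>-2 * (-1) ^ Suc k - (-1) ^ k = (-1) ^ k\<close>, while at the atom 0 one has
      \<open>4 - 2 - 1 = 1\<close>.\<close>
    also have "\<dots> = complex_of_real (2 * F n (Suc (Suc k)) - (1 - a) * 0 ^ n * (- 1) ^ Suc (Suc k) - a)"
      unfolding ge2 F2[of n k] by (simp add: algebra_simps)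
    finally show ?case .
  qed
  then show ?thesis by (simp add: F_def \<phi>_def)
qed

end


section \<open>Angle measures\<close>

text \<open>The exceptional value at pi is harmless because integer frequencies do not distinguish
  pi from -pi.\<close>

lemma cis_circle_reflection: "cis (real k * circle_reflection \<theta>) = cis (- (real k * \<theta>))"
proof (cases "\<theta> = pi")
  case True
  have "cis (- pi) = cis pi" by (simp add: complex_eq_iff)
  then have "cis (real k * pi) = cis (- (real k * pi))"
    by (metis Complex.DeMoivre mult_minus_right)
  then show ?thesis using True by (simp add: circle_reflection_def)
qed (simp add: circle_reflection_def)

lemma measurable_circle_reflection: "circle_reflection \<in> borel_measurable borel"
  unfolding circle_reflection_def by measurable

text \<open>Collects what \<open>signed_combination_circle_zero\<close> requires. Reflection
  conjugates each Fourier coefficient, so the two coefficients add up to a cosine integral.\<close>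

lemma angle_measure_facts:
  assumes "interval_spectral_measure \<tau> T \<mu>"
  defines "m \<equiv> angle_measure \<mu>"
  defines "m' \<equiv> distr m borel circle_reflection"
  shows "finite_measure m" "finite_measure m'"
    and "AE \<theta> in m. \<theta> \<in> {- pi<..pi}" "AE \<theta> in m'. \<theta> \<in> {- pi<..pi}"
    and "(LINT \<theta>|m. cis (real k * \<theta>)) + (LINT \<theta>|m'. cis (real k * \<theta>)) =
      complex_of_real (2 * (LINT x|\<mu>. cos (real k * (2 * arccos (sqrt x)))))"
proof -
  interpret prob_space \<mu>
    using assms(1) by (simp add: interval_spectral_measure_def)
  have sets: "sets \<mu> = sets borel" and range: "AE x in \<mu>. x \<in> {0..1}"
    using assms(1) by (simp_all add: interval_spectral_measure_def)
  define \<phi> :: "real \<Rightarrow> real" where "\<phi> = (\<lambda>x. 2 * arccos (sqrt x))"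
  have m: "m = distr \<mu> borel \<phi>"
    by (simp add: m_def angle_measure_def \<phi>_def)
  have \<phi>: "\<phi> \<in> borel_measurable \<mu>"
    unfolding measurable_cong_sets[OF sets refl] \<phi>_def by (rule measurable_angle)
  have m': "m' = distr \<mu> borel (\<lambda>x. circle_reflection (\<phi> x))"
    unfolding m'_def m using \<phi> measurable_circle_reflection
    by (simp add: distr_distr comp_def)
  have r\<phi>: "(\<lambda>x. circle_reflection (\<phi> x)) \<in> borel_measurable \<mu>"
    using measurable_compose[OF \<phi> measurable_circle_reflection] .
  show "finite_measure m" "finite_measure m'"
    unfolding m m' using \<phi> r\<phi> by (simp_all add: finite_measure_distr)
  have \<phi>_range: "AE x in \<mu>. 0 \<le> \<phi> x \<and> \<phi> x \<le> pi"
    using range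
  proof eventually_elim
    case (elim x)
    have "0 \<le> arccos (sqrt x)" using elim by (intro arccos_lbound) (auto intro: order_trans[of _ 0])
    moreover have "arccos (sqrt x) \<le> arccos 0"
      using elim by (intro arccos_le_arccos) auto
    ultimately show ?case by (simp add: \<phi>_def)
  qed
  have "AE x in \<mu>. \<phi> x \<in> {- pi<..pi}"
    using \<phi>_range by eventually_elim (smt (verit) greaterThanAtMost_iff pi_gt_zero)
  then show "AE \<theta> in m. \<theta> \<in> {- pi<..pi}"
    unfolding m using \<phi> by (subst AE_distr_iff) auto
  have "AE x in \<mu>. circle_reflection (\<phi> x) \<in> {- pi<..pi}"
    using \<phi>_range unfolding circle_reflection_def
    by eventually_elim (smt (verit) greaterThanAtMost_iff pi_gt_zero)
  then show "AE \<theta> in m'. \<theta> \<in> {- pi<..pi}"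
    unfolding m' using r\<phi> by (subst AE_distr_iff) auto
  have cis: "(\<lambda>\<theta>. cis (real k * \<theta>)) \<in> borel_measurable borel"
    by (intro borel_measurable_continuous_onI continuous_intros)
  have int: "integrable \<mu> (\<lambda>x. cis (real k * \<phi> x))"
    using measurable_compose[OF \<phi> cis] by (intro integrable_const_bound[where B = 1]) auto
  have int': "integrable \<mu> (\<lambda>x. cis (- (real k * \<phi> x)))"
    using integrable_cnj[OF int] by (simp add: cis_cnj)
  have "(LINT \<theta>|m. cis (real k * \<theta>)) + (LINT \<theta>|m'. cis (real k * \<theta>)) =
      (LINT x|\<mu>. cis (real k * \<phi> x)) + (LINT x|\<mu>. cis (- (real k * \<phi> x)))"
    unfolding m m' using \<phi> r\<phi> cis by (simp add: integral_distr cis_circle_reflection)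
  also have "\<dots> = (LINT x|\<mu>. complex_of_real (2 * cos (real k * \<phi> x)))"
    unfolding Bochner_Integration.integral_add[OF int int', symmetric]
    by (intro Bochner_Integration.integral_cong) (auto simp: complex_eq_iff)
  also have "\<dots> = complex_of_real (2 * (LINT x|\<mu>. cos (real k * \<phi> x)))"
    unfolding integral_complex_of_real by simp
  finally show "(LINT \<theta>|m. cis (real k * \<theta>)) + (LINT \<theta>|m'. cis (real k * \<theta>)) =
      complex_of_real (2 * (LINT x|\<mu>. cos (real k * (2 * arccos (sqrt x)))))"
    by (simp add: \<phi>_def)
qed

lemma measure_symmetrized_measure:
  assumes "finite_measure m" "sets m = sets borel" "A \<in> sets borel"
  shows "2 * measure (symmetrized_measure m) A =
    measure m A + measure (distr m borel circle_reflection) A"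
proof -
  interpret m: finite_measure m by fact
  have "circle_reflection \<in> borel_measurable m"
    unfolding measurable_cong_sets[OF assms(2) refl] by (rule measurable_circle_reflection)
  then interpret m': finite_measure "distr m borel circle_reflection"
    by (rule m.finite_measure_distr)
  have "emeasure (symmetrized_measure m) A =
      ennreal (measure m A + measure (distr m borel circle_reflection) A) / 2"
    by (simp add: emeasure_symmetrized_measure[OF assms(2,3)] m.emeasure_eq_measure
        m'.emeasure_eq_measure)
  also have "\<dots> = ennreal ((measure m A + measure (distr m borel circle_reflection) A) / 2)"
    using divide_ennreal[of "measure m A + measure (distr m borel circle_reflection) A" 2]
    by (simp del: ennreal_plus)
  finally have "measure (symmetrized_measure m) A =
      (measure m A + measure (distr m borel circle_reflection) A) / 2"
    by (intro measure_eq_emeasure_eq_ennreal) simp_all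
  then show ?thesis by simp
qed

text \<open>
  Signed combinations are needed since \<open>a\<close>, the weight of the atom at \<open>0\<close>, may be negative.
\<close>

lemma (in two_idempotents) circle_measure_eq:
  fixes a :: real
  assumes "\<tau> A = complex_of_real a"
    and \<mu>: "interval_spectral_measure \<tau> (P * Q) \<mu>"
    and \<nu>: "circle_spectral_measure \<tau> W \<nu>"
    and E: "E \<in> sets borel"
  shows "measure \<nu> E = 2 * measure (symmetrized_measure (angle_measure \<mu>)) E
    - (1 - a) * measure (return borel pi) E - a * measure (return borel 0) E"
proof -
  interpret \<nu>: prob_space \<nu>
    using \<nu> by (simp add: circle_spectral_measure_def)
  let ?m = "angle_measure \<mu>" and ?m' = "distr (angle_measure \<mu>) borel circle_reflection"
  \<comment> \<open>The claimed identity with all terms on one side; twice the symmetrization is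
    \<open>?m\<close> plus \<open>?m'\<close>, each with weight 1.\<close>
  define c where "c = (!) [1, - 1, - 1, 1 - a, a]"
  define m where "m = (!) [\<nu>, ?m, ?m', return borel pi, return borel 0]"
  have c: "c 0 = 1" "c 1 = - 1" "c 2 = - 1" "c 3 = 1 - a" "c 4 = a"
    and m: "m 0 = \<nu>" "m 1 = ?m" "m 2 = ?m'" "m 3 = return borel pi" "m 4 = return borel 0"
    by (simp_all add: c_def m_def)
  have all5: "X (m i)" if "i \<in> {..<5}" "X \<nu>" "X ?m" "X ?m'" "X (return borel pi)" "X (return borel 0)"
    for X i
  proof -
    have "i = 0 \<or> i = 1 \<or> i = 2 \<or> i = 3 \<or> i = 4" using that(1) by auto
    then show ?thesis using that(2-) m by metis
  qed
  have sum5: "(\<Sum>i\<in>{..<5}. f i) = f 0 + f 1 + f 2 + f 3 + f 4" for f :: "nat \<Rightarrow> 'z::comm_monoid_add"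
    by (simp add: eval_nat_numeral add.assoc)
  have point: "finite_measure (return borel x)" for x :: real
    by (intro prob_space.finite_measure prob_space_return) simp
  have "(\<Sum>i\<in>{..<5}. c i * measure (m i) E) = 0"
  proof (rule signed_combination_circle_zero[OF _ _ _ _ _ E])
    fix i :: nat assume i: "i \<in> {..<5}"
    show "finite_measure (m i)"
      by (rule all5[OF i]) (use angle_measure_facts[OF \<mu>] \<nu>.finite_measure_axioms point in blast)+
    show "sets (m i) = sets borel"
      by (rule all5[OF i]) (use \<nu> in \<open>simp_all add: circle_spectral_measure_def angle_measure_def\<close>)
    show "AE \<theta> in m i. \<theta> \<in> {- pi<..pi}"
    proof (rule all5[OF i])
      show "AE \<theta> in \<nu>. \<theta> \<in> {- pi<..pi}"
        using \<nu> by (simp only: circle_spectral_measure_def)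
      have "pi \<in> {- pi<..pi}" "0 \<in> {- pi<..pi}" by simp_all
      then show "AE \<theta> in return borel pi. \<theta> \<in> {- pi<..pi}" "AE \<theta> in return borel 0. \<theta> \<in> {- pi<..pi}"
        by (subst AE_return; simp)+
    qed (fact angle_measure_facts(3,4)[OF \<mu>])+
  next
    fix k :: nat
    have cis: "(\<lambda>\<theta>. cis (real k * \<theta>)) \<in> borel_measurable borel"
      by (intro borel_measurable_continuous_onI continuous_intros)
    have ret: "(LINT \<theta>|return borel x. cis (real k * \<theta>)) = cis (real k * x)" for x
      using cis by (simp add: integral_return)
    have "\<tau> (W ^ k) = (LINT \<theta>|\<nu>. cis \<theta> ^ k)"
      using \<nu> by (simp add: circle_spectral_measure_def)
    then have "(LINT \<theta>|\<nu>. cis (real k * \<theta>)) = \<tau> (W ^ k)"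
      by (simp add: Complex.DeMoivre)
    \<comment> \<open>With \<open>n = 0\<close> the factor \<open>0 ^ n\<close> is 1, so the atom at
      pi contributes.\<close>
    also have "\<dots> = complex_of_real
        (2 * (LINT x|\<mu>. cos (real k * (2 * arccos (sqrt x)))) - (1 - a) * (- 1) ^ k - a)"
      using trace_pow_C_pow_W[OF assms(1) \<mu>, of 0 k] by simp
    also have "\<dots> = (LINT \<theta>|?m. cis (real k * \<theta>)) + (LINT \<theta>|?m'. cis (real k * \<theta>))
        - (1 - a) * cis (real k * pi) - a"
      unfolding angle_measure_facts(5)[OF \<mu>] by (simp flip: Complex.DeMoivre)
    finally show "(\<Sum>i\<in>{..<5}. c i * (LINT \<theta>|m i. cis (real k * \<theta>))) = 0"
      unfolding sum5 by (simp only: c m ret) (simp add: algebra_simps)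
  qed simp
  then have "measure \<nu> E = measure ?m E + measure ?m' E
      - (1 - a) * measure (return borel pi) E - a * measure (return borel 0) E"
    unfolding sum5 c m by (simp add: algebra_simps)
  then show ?thesis
    using measure_symmetrized_measure[OF angle_measure_facts(1)[OF \<mu>] _ E]
    by (simp add: angle_measure_def)
qed

section \<open>Reduction of the process at a fixed time to two idempotents\<close>

theorem theorem4p3:
  fixes M :: "'h::complex_hilbert_space bop set"
    and \<tau> :: "'h bop \<Rightarrow> complex"
    and P Q R S :: "'h bop"
    and \<alpha> \<beta> :: real
    and B U :: "real \<Rightarrow> 'h bop"
    and \<mu> \<nu> :: "real \<Rightarrow> real measure"
  assumes "wstar_probability_space M \<tau>"
    and "P \<in> M" "projection_op P"
    and "Q \<in> M" "projection_op Q"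
    and "R = 2 *\<^sub>C P - 1"
    and "S = 2 *\<^sub>C Q - 1"
    and "complex_of_real \<alpha> = \<tau> R"
    and "complex_of_real \<beta> = \<tau> S"
    and "free_brownian_motion M \<tau> B"
    and "free_unitary_brownian_motion \<tau> B U"
    and "freely_independent \<tau> (U ` {0..}) {P, Q}"
    and "\<And>t. t \<ge> 0 \<Longrightarrow> interval_spectral_measure \<tau> (P * U t * Q * adj (U t)) (\<mu> t)"
    and "\<And>t. t \<ge> 0 \<Longrightarrow> circle_spectral_measure \<tau> (R * U t * S * adj (U t)) (\<nu> t)"
  shows "\<forall>t\<ge>0. \<forall>A\<in>sets borel.
    measure (\<nu> t) A =
      2 * measure (symmetrized_measure (angle_measure (\<mu> t))) A
      - (2 - \<alpha> - \<beta>) / 2 * measure (return borel pi) A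
      - (\<alpha> + \<beta>) / 2 * measure (return borel 0) A"
proof (intro allI impI ballI)
  fix t :: real and A :: "real set"
  assume t: "t \<ge> 0" and A: "A \<in> sets borel"
  interpret wstar_probability_space M \<tau> by fact
  \<comment> \<open>\<open>U t\<close> is adapted, so it lies in \<open>M\<close> as soon as the von
    Neumann algebra generated by the past of \<open>B\<close> does.\<close>
  have "B ` {0..t} \<subseteq> M"
    using assms(10) by (auto simp: free_brownian_motion_def)
  then have "past B t \<subseteq> M"
    unfolding past_def by (rule vN_generated_subset)
  then have U: "U t \<in> M" and unitary: "adj (U t) * U t = 1" "U t * adj (U t) = 1"
    using assms(11) t by (auto simp: free_unitary_brownian_motion_def unitary_op_def)
  have U': "adj (U t) \<in> M" by (rule adj_mem[OF U])
  define Q' where "Q' = U t * Q * adj (U t)"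
  have "Q * (Q * X) = Q * X" "adj (U t) * (U t * X) = X" for X
    using assms(5) unitary by (simp_all add: projection_op_def flip: mult.assoc)
  then have Q': "Q' * Q' = Q'" by (simp add: Q'_def mult.assoc)
  interpret two_idempotents M \<tau> P Q'
    using assms(2-5) U U' Q' by unfold_locales (auto simp: projection_op_def Q'_def mem_simps)
  have R: "R = P + P - 1" and S: "S = Q + Q - 1"
    using assms(6,7) by (simp_all add: scaleC_two_bop)
  \<comment> \<open>Traciality makes the trace invariant under unitary conjugation.\<close>
  have "\<tau> Q' = \<tau> (adj (U t) * (U t * Q))"
    unfolding Q'_def using U U' assms(4) by (intro trace_commute) (simp_all add: mem_simps)
  also have "\<dots> = \<tau> Q"
    using unitary by (simp flip: mult.assoc)
  finally have "\<tau> Q' = \<tau> Q" .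
  \<comment> \<open>Twice \<open>P + Q' - 1\<close> is \<open>R\<close> plus \<open>2Q' - 1\<close>,
    with traces \<open>\<alpha>\<close> and \<open>\<beta>\<close>.\<close>
  then have "2 * \<tau> (P + Q' - 1) = complex_of_real (\<alpha> + \<beta>)"
    using assms(2,4) P Q unfolding of_real_add assms(8,9) R S
    by (simp add: trace_add trace_diff trace_one mem_simps)
  then have a: "\<tau> (P + Q' - 1) = complex_of_real ((\<alpha> + \<beta>) / 2)"
    by (simp add: eq_divide_eq mult.commute)
  have "U t * S * adj (U t) = Q' + Q' - 1"
    unfolding S Q'_def using unitary by (simp add: algebra_simps)
  then have "R * U t * S * adj (U t) = W"
    by (simp add: R W_def mult.assoc)
  moreover have "P * U t * Q * adj (U t) = P * Q'"
    by (simp add: Q'_def mult.assoc)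
  ultimately have "measure (\<nu> t) A = 2 * measure (symmetrized_measure (angle_measure (\<mu> t))) A
      - (1 - (\<alpha> + \<beta>) / 2) * measure (return borel pi) A
      - (\<alpha> + \<beta>) / 2 * measure (return borel 0) A"
    using circle_measure_eq[of "(\<alpha> + \<beta>) / 2" "\<mu> t" "\<nu> t" A] assms(13,14)[OF t] a A
    by (simp add: A_def)
  moreover have "1 - (\<alpha> + \<beta>) / 2 = (2 - \<alpha> - \<beta>) / 2" by (simp add: field_simps)
  ultimately show "measure (\<nu> t) A = 2 * measure (symmetrized_measure (angle_measure (\<mu> t))) A
      - (2 - \<alpha> - \<beta>) / 2 * measure (return borel pi) A
      - (\<alpha> + \<beta>) / 2 * measure (return borel 0) A"
    by simp
qed

end
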